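(* Let $W_1,\dots,W_k$ be subgroups of $S_d$, let $I_m$ be a left transversal of $W_m$ in $S_d$ for $m=1,\dots,k$, and let $s\colon S_d\to S(I)$ be the action of $S_d$ on the Cartesian product $I=I_1\times\cdots\times I_k$ described in the context. Then: (i) two $k$-tuples $(i_1,\dots,i_k)$ and $(j_1,\dots,j_k)$ in $I$ are in the same $S_d$-orbit in $I$ if and only if there exist $\zeta\in S_d$ and $w_m\in W_m$ such that $j_m=\zeta i_mw_m$ for $m=1,\dots,k$; (ii) the stabilizer of the $k$-tuple $(i_1,\dots,i_k)\in I$ in the symmetric group $S_d$ is the intersection $i_1W_1i_1^{-1}\cap\cdots\cap i_kW_ki_k^{-1}$; (iii) there exists a canonical bijection between the orbit space $S_d\backslash I$ and the orbit space $$(S_d\times W_1^\circ\times\cdots\times W_k^\circ)\backslash(S_d\times\cdots\times S_d)$$ ($k$ factors $S_d$ in the second product), where the action of the group $S_d\times W_1^\circ\times\cdots\times W_k^\circ$ on the set $S_d\times\cdots\times S_d$ is given by $$(\zeta,w_1,\dots,w_k)(a_1,\dots,a_k)=(\zeta a_1w_1,\dots,\zeta a_kw_k).$$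
   Context: $S_d$ is the symmetric group of degree $d$; $(W_m)_{m=1}^k$ is a finite family of subgroups of $S_d$; $S(X)$ is the symmetric group on a set $X$; $W_m^\circ$ denotes the group $W_m$ with the opposite group structure. For each $m$, $s_m\colon S_d\to S(I_m)$ is the group homomorphism determined as follows: for $\zeta\in S_d$ and $i\in I_m$, $s_m(\zeta)(i)$ is the unique $j\in I_m$ with $j^{-1}\zeta i\in W_m$. The action $s$ is given by $s(\zeta)(i_1,\dots,i_k)=(s_1(\zeta)(i_1),\dots,s_k(\zeta)(i_k))$. *)

theory Defs
  imports
    "HOL-Algebra.Sym_Groups"
    "HOL-Algebra.Group_Action"
    "HOL-Algebra.Product_Groups"
    "HOL-Algebra.Left_Coset"
begin

definition left_transversal ::
    "('a, 'b) monoid_scheme \<Rightarrow> 'a set \<Rightarrow> 'a set \<Rightarrow> bool" where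
  "left_transversal G H T \<longleftrightarrow>
     T \<subseteq> carrier G \<and> (\<forall>C \<in> lcosets\<^bsub>G\<^esub> H. \<exists>!i. i \<in> T \<inter> C)"

definition transversal_action ::
    "('a, 'b) monoid_scheme \<Rightarrow> 'a set \<Rightarrow> 'a set \<Rightarrow> 'a \<Rightarrow> 'a \<Rightarrow> 'a" where
  "transversal_action G H T \<zeta> =
     (\<lambda>i\<in>T. THE j. j \<in> T \<and> inv\<^bsub>G\<^esub> j \<otimes>\<^bsub>G\<^esub> \<zeta> \<otimes>\<^bsub>G\<^esub> i \<in> H)"

text \<open>A \<open>k\<close>-tuple is an extensional function on \<open>{1..k}\<close>, and an element of the symmetric
  group \<^term>\<open>BijGroup X\<close> is an extensional function on \<open>X\<close>; hence the restricted
  abstractions.\<close>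

definition tuple_action ::
    "('a, 'b) monoid_scheme \<Rightarrow> nat \<Rightarrow> (nat \<Rightarrow> 'a set) \<Rightarrow> (nat \<Rightarrow> 'a set)
      \<Rightarrow> 'a \<Rightarrow> (nat \<Rightarrow> 'a) \<Rightarrow> (nat \<Rightarrow> 'a)" where
  "tuple_action G k W I \<zeta> =
     (\<lambda>i \<in> (\<Pi>\<^sub>E m\<in>{1..k}. I m). \<lambda>m\<in>{1..k}. transversal_action G (W m) (I m) \<zeta> (i m))"

definition opposite_group :: "('a, 'b) monoid_scheme \<Rightarrow> ('a, 'b) monoid_scheme" where
  "opposite_group G = G\<lparr>mult := \<lambda>x y. y \<otimes>\<^bsub>G\<^esub> x\<rparr>"

definition two_sided_group ::
    "('a, 'b) monoid_scheme \<Rightarrow> nat \<Rightarrow> (nat \<Rightarrow> 'a set) \<Rightarrow> ('a \<times> (nat \<Rightarrow> 'a)) monoid" where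
  "two_sided_group G k W =
     G \<times>\<times> product_group {1..k} (\<lambda>m. opposite_group (G\<lparr>carrier := W m\<rparr>))"

definition two_sided_action ::
    "('a, 'b) monoid_scheme \<Rightarrow> nat \<Rightarrow> 'a \<times> (nat \<Rightarrow> 'a) \<Rightarrow> (nat \<Rightarrow> 'a) \<Rightarrow> (nat \<Rightarrow> 'a)" where
  "two_sided_action G k = (\<lambda>(\<zeta>, w).
     \<lambda>a \<in> (\<Pi>\<^sub>E m\<in>{1..k}. carrier G). \<lambda>m\<in>{1..k}. \<zeta> \<otimes>\<^bsub>G\<^esub> a m \<otimes>\<^bsub>G\<^esub> w m)"

lemma opposite_group_simps [simp]:
  "carrier (opposite_group G) = carrier G"
  "x \<otimes>\<^bsub>opposite_group G\<^esub> y = y \<otimes>\<^bsub>G\<^esub> x"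
  "\<one>\<^bsub>opposite_group G\<^esub> = \<one>\<^bsub>G\<^esub>"
  by (simp_all add: opposite_group_def)

lemma group_opposite_group:
  fixes G (structure)
  assumes "group G"
  shows "group (opposite_group G)"
proof -
  interpret group G by fact
  have "\<exists>y\<in>carrier G. x \<otimes> y = \<one>" if "x \<in> carrier G" for x
    using that r_inv inv_closed by blast
  then show ?thesis
    by (intro groupI) (simp_all add: m_assoc)
qed

lemma group_two_sided_group:
  assumes "group G" "\<And>m. m \<in> {1..k} \<Longrightarrow> subgroup (W m) G"
  shows "group (two_sided_group G k W)"
  unfolding two_sided_group_def
  using assms by (intro DirProd_group product_group group_opposite_group)
    (auto intro: subgroup.subgroup_is_group)

lemma group_actionI:
  fixes G (structure)
  assumes G: "group G"
    and ext: "\<And>g. g \<in> carrier G \<Longrightarrow> \<phi> g \<in> extensional E"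
    and cl: "\<And>g x. g \<in> carrier G \<Longrightarrow> x \<in> E \<Longrightarrow> \<phi> g x \<in> E"
    and one: "\<And>x. x \<in> E \<Longrightarrow> \<phi> \<one>\<^bsub>G\<^esub> x = x"
    and mult: "\<And>g h x. g \<in> carrier G \<Longrightarrow> h \<in> carrier G \<Longrightarrow> x \<in> E \<Longrightarrow>
                  \<phi> (g \<otimes>\<^bsub>G\<^esub> h) x = \<phi> g (\<phi> h x)"
  shows "group_action G E \<phi>"
proof -
  interpret group G by fact
  have bij: "\<phi> g \<in> Bij E" if g: "g \<in> carrier G" for g
  proof -
    have "\<phi> (inv g) (\<phi> g x) = x" "\<phi> g (\<phi> (inv g) x) = x" if "x \<in> E" for x
      using that g mult[of "inv g" g x] mult[of g "inv g" x] one[of x] by auto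
    then have "bij_betw (\<phi> g) E E"
      using g cl by (intro bij_betw_byWitness[where f' = "\<phi> (inv g)"]) auto
    then show ?thesis using ext g by (simp add: Bij_def)
  qed
  have "\<phi> (g \<otimes> h) = compose E (\<phi> g) (\<phi> h)" if "g \<in> carrier G" "h \<in> carrier G" for g h
    using that ext[of "g \<otimes> h"] mult[of g h]
    by (intro extensionalityI[where A = E]) (auto simp: compose_def)
  then have "\<phi> \<in> hom G (BijGroup E)"
    using bij by (auto simp: hom_def BijGroup_def)
  then show ?thesis
    by (simp add: group_action_def group_hom_def group_hom_axioms_def group_BijGroup G)
qed

text \<open>The description of \<^const>\<open>transversal_action\<close> does denote, and the maps above are
  group actions.\<close>

lemma left_transversal_ex1:
  fixes G (structure)
  assumes G: "group G" and H: "subgroup H G" and T: "left_transversal G H T"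
    and z: "z \<in> carrier G" and i: "i \<in> T"
  shows "\<exists>!j. j \<in> T \<and> inv\<^bsub>G\<^esub> j \<otimes>\<^bsub>G\<^esub> z \<otimes>\<^bsub>G\<^esub> i \<in> H"
proof -
  interpret group G by fact
  have sub: "T \<subseteq> carrier G" using T by (simp add: left_transversal_def)
  have zi: "z \<otimes> i \<in> carrier G" using z i sub by auto
  have eq: "inv j \<otimes> z \<otimes> i \<in> H \<longleftrightarrow> j \<in> (z \<otimes> i) <# H" if "j \<in> T" for j
  proof -
    have j: "j \<in> carrier G" using that sub by auto
    have inv: "inv (inv j \<otimes> (z \<otimes> i)) = inv (z \<otimes> i) \<otimes> j"
      using j zi by (simp add: inv_mult_group)
    have "inv j \<otimes> (z \<otimes> i) \<in> H \<longleftrightarrow> inv (z \<otimes> i) \<otimes> j \<in> H"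
      by (metis H inv inv_inv j zi inv_closed m_closed subgroup.m_inv_closed)
    also have "\<dots> \<longleftrightarrow> j \<in> (z \<otimes> i) <# H"
      using subgroup.lcos_module_imp[OF H G zi] subgroup.lcos_module_rev[OF H G zi j] by blast
    finally show ?thesis using z i sub j by (auto simp: m_assoc subset_eq)
  qed
  have "(z \<otimes> i) <# H \<in> lcosets H" using zi by (auto simp: LCOSETS_def)
  then have "\<exists>!j. j \<in> T \<inter> ((z \<otimes> i) <# H)" using T by (auto simp: left_transversal_def)
  then show ?thesis using eq by (metis Int_iff)
qed

lemma group_action_transversal_action:
  fixes G (structure)
  assumes G: "group G" and H: "subgroup H G" and T: "left_transversal G H T"
  shows "group_action G T (transversal_action G H T)"
proof -
  interpret group G by fact
  let ?s = "transversal_action G H T"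
  have sub: "x \<in> carrier G" if "x \<in> T" for x
    using T that by (auto simp: left_transversal_def)
  have s: "?s g x \<in> T" "inv (?s g x) \<otimes> g \<otimes> x \<in> H"
    if "g \<in> carrier G" "x \<in> T" for g x
    using theI'[OF left_transversal_ex1[OF assms that]] that
    by (simp_all add: transversal_action_def)
  have eq: "?s g x = j" if "g \<in> carrier G" "x \<in> T" "j \<in> T" "inv j \<otimes> g \<otimes> x \<in> H" for g x j
    using left_transversal_ex1[OF assms that(1,2)] s[OF that(1,2)] that(3,4) by blast
  show ?thesis
  proof (rule group_actionI[OF G])
    show "?s g \<in> extensional T" for g by (simp add: transversal_action_def)
    show "?s g x \<in> T" if "g \<in> carrier G" "x \<in> T" for g x using s that by blast
    show "?s \<one> x = x" if "x \<in> T" for x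
      using sub[OF that] subgroup.one_closed[OF H] by (intro eq[OF _ that that]) auto
    fix g h x assume g: "g \<in> carrier G" and h: "h \<in> carrier G" and x: "x \<in> T"
    have y: "?s h x \<in> T" and z: "?s g (?s h x) \<in> T" by (rule s(1)[OF h x], rule s(1)[OF g s(1)[OF h x]])
    have "inv (?s g (?s h x)) \<otimes> g \<otimes> ?s h x \<otimes> (inv (?s h x) \<otimes> h \<otimes> x) \<in> H"
      by (rule subgroup.m_closed[OF H s(2)[OF g y] s(2)[OF h x]])
    also have "inv (?s g (?s h x)) \<otimes> g \<otimes> ?s h x \<otimes> (inv (?s h x) \<otimes> h \<otimes> x)
        = inv (?s g (?s h x)) \<otimes> g \<otimes> (?s h x \<otimes> inv (?s h x)) \<otimes> h \<otimes> x"
      using g h sub[OF x] sub[OF y] sub[OF z] by (simp only: m_assoc m_closed inv_closed)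
    also have "\<dots> = inv (?s g (?s h x)) \<otimes> (g \<otimes> h) \<otimes> x"
      using g h sub[OF x] sub[OF y] sub[OF z] by (simp add: m_assoc)
    finally show "?s (g \<otimes> h) x = ?s g (?s h x)" by (intro eq[OF _ x z]) (use g h in auto)
  qed
qed

lemma group_action_tuple_action:
  assumes G: "group G"
    and W: "\<And>m. m \<in> {1..k} \<Longrightarrow> subgroup (W m) G"
    and I: "\<And>m. m \<in> {1..k} \<Longrightarrow> left_transversal G (W m) (I m)"
  shows "group_action G (\<Pi>\<^sub>E m\<in>{1..k}. I m) (tuple_action G k W I)"
proof -
  have act: "group_action G (I m) (transversal_action G (W m) (I m))" if "m \<in> {1..k}" for m
    using group_action_transversal_action[OF G W I] that by blast
  have cl: "transversal_action G (W m) (I m) g x \<in> I m"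
    if "m \<in> {1..k}" "g \<in> carrier G" "x \<in> I m" for m g x
    using group_action.element_image[OF act] that by blast
  have one: "transversal_action G (W m) (I m) \<one>\<^bsub>G\<^esub> x = x"
    if "m \<in> {1..k}" "x \<in> I m" for m x
    using group_action.id_eq_one[OF act[OF that(1)]] that(2) by (metis restrict_apply')
  have mult: "transversal_action G (W m) (I m) (g \<otimes>\<^bsub>G\<^esub> h) x =
      transversal_action G (W m) (I m) g (transversal_action G (W m) (I m) h x)"
    if "m \<in> {1..k}" "g \<in> carrier G" "h \<in> carrier G" "x \<in> I m" for m g h x
    using group_action.composition_rule[OF act[OF that(1)] that(4,2,3)] .
  show ?thesis
  proof (rule group_actionI[OF G])
    show "tuple_action G k W I g \<in> extensional (\<Pi>\<^sub>E m\<in>{1..k}. I m)" for g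
      by (simp add: tuple_action_def)
    show cl': "tuple_action G k W I g x \<in> (\<Pi>\<^sub>E m\<in>{1..k}. I m)"
      if "g \<in> carrier G" "x \<in> (\<Pi>\<^sub>E m\<in>{1..k}. I m)" for g x
      using that cl by (auto simp: tuple_action_def PiE_iff)
    show "tuple_action G k W I \<one>\<^bsub>G\<^esub> x = x" if x: "x \<in> (\<Pi>\<^sub>E m\<in>{1..k}. I m)" for x
      using x one by (intro extensionalityI[where A = "{1..k}"])
        (auto simp: tuple_action_def PiE_iff)
    show "tuple_action G k W I (g \<otimes>\<^bsub>G\<^esub> h) x =
        tuple_action G k W I g (tuple_action G k W I h x)"
      if "g \<in> carrier G" "h \<in> carrier G" and x: "x \<in> (\<Pi>\<^sub>E m\<in>{1..k}. I m)" for g h x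
      using that cl'[of h x] mult
      by (intro extensionalityI[where A = "{1..k}"]) (auto simp: tuple_action_def PiE_iff)
  qed
qed

lemma group_action_two_sided_action:
  fixes G (structure)
  assumes G: "group G" and W: "\<And>m. m \<in> {1..k} \<Longrightarrow> subgroup (W m) G"
  shows "group_action (two_sided_group G k W) (\<Pi>\<^sub>E m\<in>{1..k}. carrier G) (two_sided_action G k)"
proof -
  interpret group G by fact
  have sub: "x \<in> carrier G" if "m \<in> {1..k}" "x \<in> W m" for m x
    using subgroup.mem_carrier[OF W] that by blast
  note defs = two_sided_action_def two_sided_group_def
  show ?thesis
  proof (rule group_actionI[OF group_two_sided_group[OF G W]])
    show "two_sided_action G k g \<in> extensional (\<Pi>\<^sub>E m\<in>{1..k}. carrier G)" for g
      by (auto simp: defs split: prod.split)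
    show cl: "two_sided_action G k g x \<in> (\<Pi>\<^sub>E m\<in>{1..k}. carrier G)"
      if "g \<in> carrier (two_sided_group G k W)" "x \<in> (\<Pi>\<^sub>E m\<in>{1..k}. carrier G)" for g x
      using that sub by (auto simp: defs PiE_iff)
    show "two_sided_action G k \<one>\<^bsub>two_sided_group G k W\<^esub> x = x"
      if "x \<in> (\<Pi>\<^sub>E m\<in>{1..k}. carrier G)" for x
      using that by (intro extensionalityI[where A = "{1..k}"]) (auto simp: defs PiE_iff)
    show "two_sided_action G k (g \<otimes>\<^bsub>two_sided_group G k W\<^esub> h) x =
        two_sided_action G k g (two_sided_action G k h x)"
      if g: "g \<in> carrier (two_sided_group G k W)" and h: "h \<in> carrier (two_sided_group G k W)"
        and x: "x \<in> (\<Pi>\<^sub>E m\<in>{1..k}. carrier G)" for g h x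
    proof -
      obtain z u where gz: "g = (z, u)" by (cases g)
      obtain y v where hy: "h = (y, v)" by (cases h)
      have c: "z \<in> carrier G" "y \<in> carrier G"
        "\<And>m. m \<in> {1..k} \<Longrightarrow> u m \<in> carrier G \<and> v m \<in> carrier G \<and> x m \<in> carrier G"
        using g h x sub unfolding gz hy by (auto simp: defs PiE_iff)
      show ?thesis
        using cl[OF h x] x c unfolding gz hy
        by (intro extensionalityI[where A = "{1..k}"]) (auto simp: defs m_assoc)
    qed
  qed
qed

end

theory Submission
  imports Defs
begin

text \<open>For \<open>i\<close>, \<open>j\<close> in \<open>I\<close>, \<open>s(\<zeta>)(i) = j\<close> means \<open>j\<^sub>m\<inverse> \<zeta> i\<^sub>m \<in> W\<^sub>m\<close>, that is
  \<open>j\<^sub>m = \<zeta> i\<^sub>m w\<^sub>m\<close> with \<open>w\<^sub>m \<in> W\<^sub>m\<close>, for all \<open>m\<close>. Hence on \<open>I\<close> the orbit relations of \<open>s\<close> and of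
  the two-sided action agree; and every two-sided orbit meets \<open>I\<close>, because each coset
  \<open>a\<^sub>m W\<^sub>m\<close> contains an element of \<open>I\<^sub>m\<close>.\<close>

lemma (in group_action) orbit_subset: "x \<in> E \<Longrightarrow> orbit G \<phi> x \<subseteq> E"
  using element_image by (auto simp: orbit_def)

text \<open>Symmetry and transitivity of the orbit relation on \<open>E\<close> give both
  inclusions.\<close>

lemma (in group_action) orbit_eq:
  assumes "x \<in> E" "y \<in> orbit G \<phi> x"
  shows "orbit G \<phi> y = orbit G \<phi> x"
proof -
  have y: "y \<in> E" using assms orbit_subset by blast
  have "z \<in> orbit G \<phi> y \<longleftrightarrow> z \<in> orbit G \<phi> x" for z
    using orbit_trans[OF y assms(1) _ orbit_sym[OF assms(1) y assms(2)]]
      orbit_trans[OF assms(1) y _ assms(2)] orbit_subset[OF y] orbit_subset[OF assms(1)]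
    by blast
  then show ?thesis by blast
qed

text \<open>The map sends an orbit in \<open>E\<close> to the \<open>H\<close>-orbit containing it.
  Since the two orbit relations agree on \<open>E\<close>, it is well defined and injective;
  \<open>meets\<close> makes it surjective. The last conjunct fixes the value of \<Phi> on every
  orbit and is the sense in which the bijection is canonical.\<close>

lemma two_actions_orbits_bij:
  assumes "group_action G E \<phi>" and "group_action H F \<psi>" and "E \<subseteq> F"
    and same: "\<And>x y. x \<in> E \<Longrightarrow> y \<in> E \<Longrightarrow> y \<in> orbit G \<phi> x \<longleftrightarrow> y \<in> orbit H \<psi> x"
    and meets: "\<And>y. y \<in> F \<Longrightarrow> \<exists>x\<in>E. x \<in> orbit H \<psi> y"
  shows "\<exists>\<Phi>. bij_betw \<Phi> (orbits G E \<phi>) (orbits H F \<psi>) \<and>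
           (\<forall>x\<in>E. \<Phi> (orbit G \<phi> x) = orbit H \<psi> x)"
proof -
  interpret A: group_action G E \<phi> by fact
  interpret B: group_action H F \<psi> by fact
  have inF: "x \<in> F" if "x \<in> E" for x
    using that \<open>E \<subseteq> F\<close> by blast
  \<comment> \<open>Taking a union avoids a choice of representative: the points of one
    \<open>G\<close>-orbit all have the same \<open>H\<close>-orbit, so the union is that single
    orbit.\<close>
  define \<Phi> where "\<Phi> C = (\<Union>x\<in>C. orbit H \<psi> x)" for C
  have \<Phi>: "\<Phi> (orbit G \<phi> x) = orbit H \<psi> x" if x: "x \<in> E" for x
  proof -
    have "orbit H \<psi> y = orbit H \<psi> x" if "y \<in> orbit G \<phi> x" for y
      using that B.orbit_eq[OF inF[OF x]] same[OF x] A.orbit_subset[OF x] by blast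
    moreover have "x \<in> orbit G \<phi> x" by (rule A.orbit_refl[OF x])
    ultimately show ?thesis unfolding \<Phi>_def by blast
  qed
  have "inj_on \<Phi> (orbits G E \<phi>)"
  proof (rule inj_onI)
    fix C D assume "C \<in> orbits G E \<phi>" "D \<in> orbits G E \<phi>" "\<Phi> C = \<Phi> D"
    then obtain x y where x: "x \<in> E" "C = orbit G \<phi> x" and y: "y \<in> E" "D = orbit G \<phi> y"
      and "orbit H \<psi> x = orbit H \<psi> y"
      using \<Phi> by (auto simp: orbits_def)
    \<comment> \<open>\<open>y\<close> lies in its own \<open>H\<close>-orbit, which is also that of
      \<open>x\<close>; \<open>same\<close> then carries this relation back to
      \<open>G\<close>.\<close>
    then have "y \<in> orbit H \<psi> x" using B.orbit_refl[OF inF] by blast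
    then have "y \<in> orbit G \<phi> x" using x y same by blast
    then show "C = D" using x y A.orbit_eq by blast
  qed
  moreover have "\<Phi> ` orbits G E \<phi> = orbits H F \<psi>"
  proof
    show "\<Phi> ` orbits G E \<phi> \<subseteq> orbits H F \<psi>"
      using \<Phi> inF by (auto simp: orbits_def)
    show "orbits H F \<psi> \<subseteq> \<Phi> ` orbits G E \<phi>"
    proof
      fix C assume "C \<in> orbits H F \<psi>"
      then obtain y where y: "y \<in> F" "C = orbit H \<psi> y" by (auto simp: orbits_def)
      then obtain x where x: "x \<in> E" "x \<in> orbit H \<psi> y" using meets by blast
      then have "C = \<Phi> (orbit G \<phi> x)" using y B.orbit_eq \<Phi> by simp
      then show "C \<in> \<Phi> ` orbits G E \<phi>" using x by (auto simp: orbits_def)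
    qed
  qed
  ultimately show ?thesis using \<Phi> by (auto simp: bij_betw_def)
qed

text \<open>Links the orbit space, where two points share some orbit, to the orbit of a given point,
  which is easier to compute.\<close>

lemma (in group_action) mem_same_orbit_iff:
  assumes "x \<in> E" "y \<in> E"
  shows "(\<exists>C\<in>orbits G E \<phi>. x \<in> C \<and> y \<in> C) \<longleftrightarrow> y \<in> orbit G \<phi> x"
proof
  assume "\<exists>C\<in>orbits G E \<phi>. x \<in> C \<and> y \<in> C"
  then obtain z where "z \<in> E" "x \<in> orbit G \<phi> z" "y \<in> orbit G \<phi> z"
    by (auto simp: orbits_def)
  then show "y \<in> orbit G \<phi> x"
    using assms orbit_sym orbit_trans by blast
next
  assume "y \<in> orbit G \<phi> x"
  then show "\<exists>C\<in>orbits G E \<phi>. x \<in> C \<and> y \<in> C"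
    using assms orbit_refl by (auto simp: orbits_def)
qed

text \<open>The only candidate for \<open>h\<close> is \<open>inv x \<otimes> y\<close>, the inverse
  of \<open>inv y \<otimes> x\<close>, and \<open>H\<close> is closed under inverses. This turns the
  condition defining the transversal action into an explicit factor from the subgroup.\<close>

lemma (in group) inv_mult_mem_subgroup_iff:
  assumes "subgroup H G" "x \<in> carrier G" "y \<in> carrier G"
  shows "inv y \<otimes> x \<in> H \<longleftrightarrow> (\<exists>h\<in>H. y = x \<otimes> h)"
proof
  assume "inv y \<otimes> x \<in> H"
  then have "inv (inv y \<otimes> x) \<in> H" by (rule subgroup.m_inv_closed[OF assms(1)])
  moreover have "y = x \<otimes> inv (inv y \<otimes> x)"
    using assms by (simp add: inv_mult_group m_assoc[symmetric])
  ultimately show "\<exists>h\<in>H. y = x \<otimes> h" by blast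
next
  assume "\<exists>h\<in>H. y = x \<otimes> h"
  then obtain h where h: "h \<in> H" "y = x \<otimes> h" by blast
  have "h \<in> carrier G" using assms(1) h(1) by (rule subgroup.mem_carrier)
  then have "inv y \<otimes> x = inv h"
    using assms h by (simp add: inv_mult_group m_assoc)
  then show "inv y \<otimes> x \<in> H" using h subgroup.m_inv_closed[OF assms(1)] by simp
qed

text \<open>Conjugation by \<open>x\<close> is undone by conjugation by \<open>inv x\<close>. The
  right-hand side is the condition under which a transversal element \<open>x\<close> is fixed by
  \<open>z\<close>.\<close>

lemma (in group) mem_conjugate_subgroup_iff:
  assumes "subgroup H G" "x \<in> carrier G" "z \<in> carrier G"
  shows "z \<in> x <# H #> inv x \<longleftrightarrow> inv x \<otimes> z \<otimes> x \<in> H"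
proof
  assume "z \<in> x <# H #> inv x"
  then obtain h where h: "h \<in> H" "z = x \<otimes> h \<otimes> inv x"
    by (auto simp: l_coset_def r_coset_def)
  have "h \<in> carrier G" using assms(1) h(1) by (rule subgroup.mem_carrier)
  then have "inv x \<otimes> z \<otimes> x = h"
    using assms h by (simp add: m_assoc inv_solve_left')
  then show "inv x \<otimes> z \<otimes> x \<in> H" using h by simp
next
  assume *: "inv x \<otimes> z \<otimes> x \<in> H"
  have "x \<otimes> (inv x \<otimes> z \<otimes> x) \<otimes> inv x = (x \<otimes> inv x) \<otimes> z \<otimes> (x \<otimes> inv x)"
    using assms by (simp only: m_assoc m_closed inv_closed)
  then have "z = x \<otimes> (inv x \<otimes> z \<otimes> x) \<otimes> inv x"
    using assms by simp
  then show "z \<in> x <# H #> inv x"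
    using * by (auto simp: l_coset_def r_coset_def)
qed

text \<open>By \<open>left_transversal_ex1\<close> exactly one element of \<open>T\<close> satisfies
  the condition, so satisfying it and being the described value are the same.\<close>

lemma transversal_action_eq_iff:
  fixes G (structure)
  assumes "group G" "subgroup H G" "left_transversal G H T"
    and "z \<in> carrier G" "i \<in> T" "j \<in> T"
  shows "transversal_action G H T z i = j \<longleftrightarrow> inv j \<otimes> z \<otimes> i \<in> H"
  using theI'[OF left_transversal_ex1[OF assms(1-5)]] left_transversal_ex1[OF assms(1-5)] assms(5,6)
  unfolding transversal_action_def by auto

text \<open>The setting is an arbitrary group; the symmetric group is substituted in the final
  theorem.\<close>

locale transversal_family = group G for G (structure) +
  fixes k :: nat and W I :: "nat \<Rightarrow> 'a set"
  assumes subgroups: "\<And>m. m \<in> {1..k} \<Longrightarrow> subgroup (W m) G"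
    and transversals: "\<And>m. m \<in> {1..k} \<Longrightarrow> left_transversal G (W m) (I m)"
begin

abbreviation "tuples \<equiv> \<Pi>\<^sub>E m\<in>{1..k}. I m"
abbreviation "full_tuples \<equiv> \<Pi>\<^sub>E m\<in>{1..k}. carrier G"

sublocale tuple: group_action G tuples "tuple_action G k W I"
  by (rule group_action_tuple_action[OF is_group subgroups transversals])

sublocale two_sided: group_action "two_sided_group G k W" full_tuples "two_sided_action G k"
  by (rule group_action_two_sided_action[OF is_group subgroups])

lemma transversal_carrier: "m \<in> {1..k} \<Longrightarrow> x \<in> I m \<Longrightarrow> x \<in> carrier G"
  using transversals[of m] by (auto simp: left_transversal_def)

lemma tuples_subset: "tuples \<subseteq> full_tuples"
  using transversal_carrier by (intro PiE_mono) blast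

text \<open>Both sides of the equation are extensional tuples, so equality is tested in each
  component, where \<open>transversal_action_eq_iff\<close> applies.\<close>

lemma tuple_action_eq_iff:
  assumes "z \<in> carrier G" "i \<in> tuples" "j \<in> tuples"
  shows "tuple_action G k W I z i = j \<longleftrightarrow> (\<forall>m\<in>{1..k}. inv (j m) \<otimes> z \<otimes> i m \<in> W m)"
proof -
  have "tuple_action G k W I z i = j \<longleftrightarrow>
      (\<forall>m\<in>{1..k}. tuple_action G k W I z i m = j m)"
    using PiE_ext[OF tuple.element_image[OF assms(1,2) refl] assms(3)] by auto
  also have "\<dots> \<longleftrightarrow> (\<forall>m\<in>{1..k}. transversal_action G (W m) (I m) z (i m) = j m)"
    using assms(2) by (simp add: tuple_action_def)
  also have "\<dots> \<longleftrightarrow> (\<forall>m\<in>{1..k}. inv (j m) \<otimes> z \<otimes> i m \<in> W m)"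
    using transversal_action_eq_iff[OF is_group subgroups transversals assms(1)] assms(2,3)
    by (intro ball_cong refl) (meson PiE_mem)
  finally show ?thesis .
qed

text \<open>The condition of \<open>tuple_action_eq_iff\<close> is solved for \<open>j m\<close> in
  each component.\<close>

lemma mem_tuple_orbit_iff:
  assumes "i \<in> tuples" "j \<in> tuples"
  shows "j \<in> orbit G (tuple_action G k W I) i \<longleftrightarrow>
    (\<exists>z\<in>carrier G. \<exists>w. \<forall>m\<in>{1..k}. w m \<in> W m \<and> j m = z \<otimes> i m \<otimes> w m)"
proof -
  have "inv (j m) \<otimes> z \<otimes> i m \<in> W m \<longleftrightarrow> (\<exists>w\<in>W m. j m = z \<otimes> i m \<otimes> w)"
    if "z \<in> carrier G" "m \<in> {1..k}" for z m
    using that assms transversal_carrier inv_mult_mem_subgroup_iff[OF subgroups, of m "z \<otimes> i m" "j m"]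
    by (metis PiE_mem inv_closed m_assoc m_closed)
  \<comment> \<open>For fixed \<open>z\<close>, the factors found separately for each
    \<open>m\<close> are collected into one function \<open>w\<close> by choice.\<close>
  then have "tuple_action G k W I z i = j \<longleftrightarrow>
      (\<exists>w. \<forall>m\<in>{1..k}. w m \<in> W m \<and> j m = z \<otimes> i m \<otimes> w m)"
    if "z \<in> carrier G" for z
    using that tuple_action_eq_iff[OF that assms] by (simp add: Bex_def bchoice_iff)
  then show ?thesis unfolding orbit_def by blast
qed

text \<open>This is the case \<open>j = i\<close> of \<open>tuple_action_eq_iff\<close>, read as
  membership in conjugates. Intersecting with \<open>carrier G\<close> gives the right value for
  \<open>k = 0\<close>, where the family of conjugates is empty.\<close>

lemma stabilizer_tuple_action:
  assumes "i \<in> tuples"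
  shows "stabilizer G (tuple_action G k W I) i =
    carrier G \<inter> (\<Inter>m\<in>{1..k}. i m <# W m #> inv (i m))"
proof -
  have "z \<in> i m <# W m #> inv (i m) \<longleftrightarrow> inv (i m) \<otimes> z \<otimes> i m \<in> W m"
    if "z \<in> carrier G" "m \<in> {1..k}" for z m
    using that assms by (intro mem_conjugate_subgroup_iff subgroups) (auto intro!: transversal_carrier[of m])
  then show ?thesis
    using tuple_action_eq_iff[OF _ assms assms] by (auto simp: stabilizer_def)
qed

text \<open>Puts the two-sided orbit relation into the same form as
  \<open>mem_tuple_orbit_iff\<close>, so that the two can be compared on
  \<open>tuples\<close>.\<close>

lemma mem_two_sided_orbit_iff:
  assumes "a \<in> full_tuples" "b \<in> full_tuples"
  shows "b \<in> orbit (two_sided_group G k W) (two_sided_action G k) a \<longleftrightarrow>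
    (\<exists>z\<in>carrier G. \<exists>w. \<forall>m\<in>{1..k}. w m \<in> W m \<and> b m = z \<otimes> a m \<otimes> w m)"
proof
  assume "b \<in> orbit (two_sided_group G k W) (two_sided_action G k) a"
  then obtain z w where z: "z \<in> carrier G" and w: "w \<in> (\<Pi>\<^sub>E m\<in>{1..k}. W m)"
    and b: "b = two_sided_action G k (z, w) a"
    by (auto simp: orbit_def two_sided_group_def)
  then have "\<forall>m\<in>{1..k}. w m \<in> W m \<and> b m = z \<otimes> a m \<otimes> w m"
    using assms(1) by (auto simp: two_sided_action_def)
  then show "\<exists>z\<in>carrier G. \<exists>w. \<forall>m\<in>{1..k}. w m \<in> W m \<and> b m = z \<otimes> a m \<otimes> w m"
    using z by blast
next
  assume "\<exists>z\<in>carrier G. \<exists>w. \<forall>m\<in>{1..k}. w m \<in> W m \<and> b m = z \<otimes> a m \<otimes> w m"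
  then obtain z w where z: "z \<in> carrier G"
    and w: "\<forall>m\<in>{1..k}. w m \<in> W m \<and> b m = z \<otimes> a m \<otimes> w m" by blast
  \<comment> \<open>Elements of the product group are extensional, while \<open>w\<close> is
    arbitrary outside \<open>{1..k}\<close>; hence the restriction.\<close>
  have g: "(z, restrict w {1..k}) \<in> carrier (two_sided_group G k W)"
    using z w by (auto simp: two_sided_group_def)
  have "two_sided_action G k (z, restrict w {1..k}) a = b"
    using assms w by (intro extensionalityI[where A = "{1..k}"])
      (auto simp: two_sided_action_def PiE_iff)
  then show "b \<in> orbit (two_sided_group G k W) (two_sided_action G k) a"
    using g unfolding orbit_def by blast
qed

lemma two_sided_orbit_meets_tuples:
  assumes "a \<in> full_tuples"
  shows "\<exists>i\<in>tuples. i \<in> orbit (two_sided_group G k W) (two_sided_action G k) a"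
proof -
  \<comment> \<open>The transversal meets the coset of \<open>a m\<close>, and its representative
    there is \<open>a m\<close> times an element of \<open>W m\<close>.\<close>
  have "\<exists>w. w \<in> W m \<and> a m \<otimes> w \<in> I m" if m: "m \<in> {1..k}" for m
  proof -
    have "a m <# W m \<in> lcosets (W m)" using assms m by (auto simp: LCOSETS_def)
    then obtain x where "x \<in> I m" "x \<in> a m <# W m"
      using transversals[OF m] unfolding left_transversal_def by blast
    then show ?thesis by (auto simp: l_coset_def)
  qed
  then obtain w where w: "\<And>m. m \<in> {1..k} \<Longrightarrow> w m \<in> W m \<and> a m \<otimes> w m \<in> I m"
    by metis
  define i where "i = (\<lambda>m\<in>{1..k}. a m \<otimes> w m)"
  have i: "i \<in> tuples" using w by (auto simp: i_def)
  \<comment> \<open>Right multiplication alone moves \<open>a\<close> into \<open>tuples\<close>, so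
    the left factor is taken to be \<open>\<one>\<close>.\<close>
  have "\<forall>m\<in>{1..k}. w m \<in> W m \<and> i m = \<one> \<otimes> a m \<otimes> w m"
    using w assms by (auto simp: i_def PiE_iff)
  then have "i \<in> orbit (two_sided_group G k W) (two_sided_action G k) a"
    using mem_two_sided_orbit_iff[OF assms, of i] i tuples_subset by blast
  then show ?thesis using i by blast
qed

lemma orbits_bij:
  "\<exists>\<Phi>. bij_betw \<Phi> (orbits G tuples (tuple_action G k W I))
         (orbits (two_sided_group G k W) full_tuples (two_sided_action G k)) \<and>
       (\<forall>i\<in>tuples. \<Phi> (orbit G (tuple_action G k W I) i) =
         orbit (two_sided_group G k W) (two_sided_action G k) i)"
proof (rule two_actions_orbits_bij[OF tuple.group_action_axioms two_sided.group_action_axioms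
      tuples_subset])
  fix i j assume "i \<in> tuples" "j \<in> tuples"
  then show "j \<in> orbit G (tuple_action G k W I) i \<longleftrightarrow>
      j \<in> orbit (two_sided_group G k W) (two_sided_action G k) i"
    \<comment> \<open>Both memberships rewrite to the same formula in \<open>z\<close> and
      \<open>w\<close>.\<close>
    by (simp only: mem_tuple_orbit_iff mem_two_sided_orbit_iff subsetD[OF tuples_subset])
qed (rule two_sided_orbit_meets_tuples)

end

theorem lemma1p2p3:
  fixes d k :: nat and W I :: "nat \<Rightarrow> (nat \<Rightarrow> nat) set"
  assumes "\<And>m. m \<in> {1..k} \<Longrightarrow> subgroup (W m) (sym_group d)"
    and "\<And>m. m \<in> {1..k} \<Longrightarrow> left_transversal (sym_group d) (W m) (I m)"
  shows "(\<forall>i \<in> (\<Pi>\<^sub>E m\<in>{1..k}. I m). \<forall>j \<in> (\<Pi>\<^sub>E m\<in>{1..k}. I m).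
            (\<exists>C \<in> orbits (sym_group d) (\<Pi>\<^sub>E m\<in>{1..k}. I m) (tuple_action (sym_group d) k W I).
               i \<in> C \<and> j \<in> C) \<longleftrightarrow>
            (\<exists>\<zeta> \<in> carrier (sym_group d). \<exists>w. \<forall>m\<in>{1..k}. w m \<in> W m \<and>
               j m = \<zeta> \<otimes>\<^bsub>sym_group d\<^esub> i m \<otimes>\<^bsub>sym_group d\<^esub> w m)) \<and>
         (\<forall>i \<in> (\<Pi>\<^sub>E m\<in>{1..k}. I m).
            stabilizer (sym_group d) (tuple_action (sym_group d) k W I) i =
            carrier (sym_group d) \<inter>
            (\<Inter>m\<in>{1..k}. i m <#\<^bsub>sym_group d\<^esub> W m #>\<^bsub>sym_group d\<^esub> inv\<^bsub>sym_group d\<^esub> (i m))) \<and>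
         (\<exists>\<Phi>. bij_betw \<Phi>
              (orbits (sym_group d) (\<Pi>\<^sub>E m\<in>{1..k}. I m) (tuple_action (sym_group d) k W I))
              (orbits (two_sided_group (sym_group d) k W) (\<Pi>\<^sub>E m\<in>{1..k}. carrier (sym_group d))
                 (two_sided_action (sym_group d) k)) \<and>
            (\<forall>i \<in> (\<Pi>\<^sub>E m\<in>{1..k}. I m).
               \<Phi> (orbit (sym_group d) (tuple_action (sym_group d) k W I) i) =
               orbit (two_sided_group (sym_group d) k W) (two_sided_action (sym_group d) k) i))"
proof -
  interpret transversal_family "sym_group d" k W I
    using assms by (simp add: transversal_family_def transversal_family_axioms_def sym_group_is_group)
  show ?thesis
    by (intro conjI ballI orbits_bij stabilizer_tuple_action)
      (simp only: tuple.mem_same_orbit_iff mem_tuple_orbit_iff)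
qed

end
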